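(* Let $\beta_1,\beta_2>0$, $-1<\rho<1$, and let $Z$ be the moving maximum process on $\mathbb{R}^2$ generated by the general normal density $$\phi(u_1,u_2)=\frac{\beta_1\beta_2}{2\pi\sqrt{1-\rho^2}}\exp\left\{-\frac1{2(1-\rho^2)}\left[\beta_1^2u_1^2-2\rho\beta_1\beta_2u_1u_2+\beta_2^2u_2^2\right]\right\}.$$ Put $$\Sigma^{-1}=\frac1{1-\rho^2}\begin{bmatrix}\beta_1^2&-\rho\beta_1\beta_2\\-\rho\beta_1\beta_2&\beta_2^2\end{bmatrix},$$ and let $\Phi$ be the standard normal distribution function. Then for $\mathbf{t}=(t_1,t_2)^T\in\mathbb{R}^2$, $\mathbf{t}\neq 0$, and all $w_1,w_2>0$, $$-\log P\{Z(0,0)\le w_1,Z(t_1,t_2)\le w_2\}=\frac1{w_1}\Phi\left(\frac{\sqrt{\mathbf{t}^T\Sigma^{-1}\mathbf{t}}}{2}+\frac1{\sqrt{\mathbf{t}^T\Sigma^{-1}\mathbf{t}}}\log\frac{w_2}{w_1}\right)+\frac1{w_2}\Phi\left(\frac{\sqrt{\mathbf{t}^T\Sigma^{-1}\mathbf{t}}}{2}+\frac1{\sqrt{\mathbf{t}^T\Sigma^{-1}\mathbf{t}}}\log\frac{w_1}{w_2}\right).$$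
   Context: For a unimodal (nonincreasing in each direction starting from the mode) continuous probability density $\phi$ on $\mathbb{R}^2$, let $\{(X_j,W_j,Y_j)\}_{j\ge1}$ be the points of a homogeneous (unit intensity) Poisson process on $\mathbb{R}^2\times\mathbb{R}_+$. The moving maximum process on $\mathbb{R}^2$ generated by $\phi$ is $$Z(t_1,t_2):=\max_{j\ge1}\frac{\phi(X_j-t_1,W_j-t_2)}{Y_j},\qquad (t_1,t_2)\in\mathbb{R}^2.$$ It is stationary and simple max-stable, and for $\mathbf{t}_i\in\mathbb{R}^2$, $x_i>0$, $$P\{Z(\mathbf{t}_1)\le x_1,\dots,Z(\mathbf{t}_d)\le x_d\}=\exp\left\{-\int_{\mathbb{R}^2}\max_{1\le i\le d}\frac{\phi(\mathbf{s}-\mathbf{t}_i)}{x_i}\,d\mathbf{s}\right\}.$$ *)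

theory Defs
  imports "HOL-Probability.Probability"
begin

text \<open>
  A Poisson process with intensity measure \<open>\<mu>\<close>, given by an enumeration \<open>P\<close> of its points.
  Counts take values in \<^typ>\<open>ennreal\<close> because a set of infinite intensity contains infinitely
  many points almost surely. Points are counted by index, that is, with multiplicity.
  The Poisson probabilities are written out because \<^const>\<open>poisson_pmf\<close> is specified only for
  positive rates, while \<open>\<mu> A = 0\<close> is allowed here.
\<close>

locale poisson_process = prob_space M
  for M :: "'a measure" and \<mu> :: "'b measure" and P :: "nat \<Rightarrow> 'a \<Rightarrow> 'b" +
  assumes measurable_point: "\<And>j. P j \<in> measurable M \<mu>"
    and count_poisson: "\<And>A k. A \<in> sets \<mu> \<Longrightarrow> emeasure \<mu> A < \<infinity> \<Longrightarrow>
      prob {\<omega> \<in> space M. emeasure (count_space UNIV) {j. P j \<omega> \<in> A} = of_nat k}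
        = measure \<mu> A ^ k / fact k * exp (- measure \<mu> A)"
    and count_indep: "\<And>(A :: nat \<Rightarrow> 'b set) I.
      finite I \<Longrightarrow> A ` I \<subseteq> sets \<mu> \<Longrightarrow> disjoint_family_on A I \<Longrightarrow>
      indep_vars (\<lambda>_. borel) (\<lambda>i \<omega>. emeasure (count_space UNIV) {j. P j \<omega> \<in> A i}) I"

text \<open>
  Lebesgue measure on the product of the plane and the positive half-line. The boundary
  \<open>y = 0\<close>, a null set, is left out so that division by the last coordinate is always proper.
\<close>

definition half_space_measure :: "(real \<times> real \<times> real) measure" where
  "half_space_measure = restrict_space lborel (UNIV \<times> UNIV \<times> {0<..})"

text \<open>
  The maximum over the points is taken as a supremum in the extended reals. The two agree
  whenever the maximum is attained, which for a probability density \<open>\<phi>\<close> and a unit-rate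
  Poisson process on the half-space happens almost surely for each \<open>(t\<^sub>1, t\<^sub>2)\<close>: only finitely
  many points have a value above any given positive level.
\<close>

definition moving_max ::
  "(real \<Rightarrow> real \<Rightarrow> real) \<Rightarrow> (nat \<Rightarrow> 'a \<Rightarrow> real) \<Rightarrow> (nat \<Rightarrow> 'a \<Rightarrow> real) \<Rightarrow> (nat \<Rightarrow> 'a \<Rightarrow> real)
    \<Rightarrow> real \<Rightarrow> real \<Rightarrow> 'a \<Rightarrow> ereal" where
  "moving_max \<phi> X W Y t1 t2 \<omega> = (SUP j. ereal (\<phi> (X j \<omega> - t1) (W j \<omega> - t2) / Y j \<omega>))"

definition normal_density2 :: "real \<Rightarrow> real \<Rightarrow> real \<Rightarrow> real \<Rightarrow> real \<Rightarrow> real" where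
  "normal_density2 \<beta>1 \<beta>2 \<rho> u1 u2 =
     \<beta>1 * \<beta>2 / (2 * pi * sqrt (1 - \<rho>\<^sup>2)) *
     exp (- (1 / (2 * (1 - \<rho>\<^sup>2))) *
       (\<beta>1\<^sup>2 * u1\<^sup>2 - 2 * \<rho> * \<beta>1 * \<beta>2 * u1 * u2 + \<beta>2\<^sup>2 * u2\<^sup>2))"

definition Sigma_inv :: "real \<Rightarrow> real \<Rightarrow> real \<Rightarrow> real ^ 2 ^ 2" where
  "Sigma_inv \<beta>1 \<beta>2 \<rho> = (1 / (1 - \<rho>\<^sup>2)) *\<^sub>R
     vector [vector [\<beta>1\<^sup>2, - \<rho> * \<beta>1 * \<beta>2],
             vector [- \<rho> * \<beta>1 * \<beta>2, \<beta>2\<^sup>2]]"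

abbreviation Phi :: "real \<Rightarrow> real" where
  "Phi \<equiv> cdf std_normal_distribution"

end

theory Submission
  imports Defs
begin

text \<open>
  The event says that no point of the process lies below the graph of
  \<open>max (\<phi>(s) / w\<^sub>1) (\<phi>(s - t) / w\<^sub>2)\<close>, so its probability is the exponential of minus the
  volume of that region. The linear map whose components are \<open>\<langle>t, s\<rangle> / q\<close> and
  \<open>sqrt (det \<Sigma>\<^sup>-\<^sup>1) (t \<times> s) / q\<close>, where \<open>\<langle>\<cdot>, \<cdot>\<rangle>\<close> is the bilinear form of \<open>\<Sigma>\<^sup>-\<^sup>1\<close>, standardises
  the normal density and sends \<open>t\<close> to \<open>(q, 0)\<close>. The second coordinate integrates out, and what
  remains is the integral of the maximum of two shifted one-dimensional normal densities, which
  cross exactly once.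
\<close>

section \<open>From the joint distribution of two maxima to the volume of a region\<close>

lemma (in poisson_process) prob_no_points:
  assumes "A \<in> sets \<mu>" and "emeasure \<mu> A < \<infinity>"
  shows "prob {\<omega> \<in> space M. \<forall>j. P j \<omega> \<notin> A} = exp (- measure \<mu> A)"
proof -
  have "{\<omega> \<in> space M. \<forall>j. P j \<omega> \<notin> A} =
      {\<omega> \<in> space M. emeasure (count_space UNIV) {j. P j \<omega> \<in> A} = of_nat 0}"
    by (auto simp: emeasure_count_space_eq_0)
  then show ?thesis
    using count_poisson[OF assms, of 0] by simp
qed

text \<open>By Tonelli, since the fibre of \<open>A\<close> over \<open>(x, w)\<close> is an open
  interval of length \<open>m x w\<close>. The strict bound \<open>y < m x w\<close> is what makes
  avoiding \<open>A\<close> match the weak inequalities \<open>\<le>\<close> between the maxima and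
  their levels.\<close>

lemma emeasure_below_graph:
  fixes m :: "real \<Rightarrow> real \<Rightarrow> real"
  assumes [measurable]: "case_prod m \<in> borel_measurable (borel \<Otimes>\<^sub>M borel)"
    and nonneg: "\<And>x w. 0 \<le> m x w"
  defines "A \<equiv> {(x, w, y). 0 < y \<and> y < m x w}"
  shows "A \<in> sets half_space_measure"
    and "emeasure half_space_measure A = (\<integral>\<^sup>+x. \<integral>\<^sup>+w. ennreal (m x w) \<partial>lborel \<partial>lborel)"
proof -
  have "{z \<in> space (borel \<Otimes>\<^sub>M borel \<Otimes>\<^sub>M borel). 0 < snd (snd z) \<and>
      snd (snd z) < case_prod m (fst z, fst (snd z))} \<in> sets (borel \<Otimes>\<^sub>M borel \<Otimes>\<^sub>M borel)"
    by measurable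
  also have "{z \<in> space (borel \<Otimes>\<^sub>M borel \<Otimes>\<^sub>M borel). 0 < snd (snd z) \<and>
      snd (snd z) < case_prod m (fst z, fst (snd z))} = A"
    by (auto simp: A_def space_pair_measure)
  finally have A: "A \<in> sets (borel \<Otimes>\<^sub>M borel \<Otimes>\<^sub>M borel)" .
  then have A_borel: "A \<in> sets borel"
    unfolding borel_prod .
  have half: "UNIV \<times> UNIV \<times> {0<..} \<in> sets (borel :: (real \<times> real \<times> real) measure)"
    by (intro borel_open open_Times) auto
  have sub: "A \<subseteq> UNIV \<times> UNIV \<times> {0<..}"
    by (auto simp: A_def)
  show "A \<in> sets half_space_measure"
    using A_borel half sub by (auto simp: half_space_measure_def sets_restrict_space_iff)
  have "emeasure half_space_measure A = emeasure lborel A"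
    using half sub by (simp add: half_space_measure_def emeasure_restrict_space)
  also have "\<dots> = emeasure (lborel \<Otimes>\<^sub>M (lborel \<Otimes>\<^sub>M lborel)) A"
    by (simp add: lborel_prod)
  also have "\<dots> = (\<integral>\<^sup>+x. emeasure (lborel \<Otimes>\<^sub>M lborel) (Pair x -` A) \<partial>lborel)"
  proof (rule sigma_finite_measure.emeasure_pair_measure_alt)
    show "sigma_finite_measure (lborel \<Otimes>\<^sub>M lborel :: (real \<times> real) measure)"
      unfolding lborel_prod by (rule lborel.sigma_finite_measure_axioms)
    show "A \<in> sets (lborel \<Otimes>\<^sub>M (lborel \<Otimes>\<^sub>M lborel))"
      using A_borel unfolding lborel_prod by simp
  qed
  also have "\<dots> = (\<integral>\<^sup>+x. \<integral>\<^sup>+w. ennreal (m x w) \<partial>lborel \<partial>lborel)"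
  proof (intro nn_integral_cong)
    fix x :: real
    have "Pair x -` A \<in> sets (borel \<Otimes>\<^sub>M borel)"
      using A by (rule sets_Pair1)
    then have "emeasure (lborel \<Otimes>\<^sub>M lborel) (Pair x -` A) =
        (\<integral>\<^sup>+w. emeasure lborel (Pair w -` Pair x -` A) \<partial>lborel)"
      by (intro lborel.emeasure_pair_measure_alt) (simp add: borel_prod lborel_prod)
    also have "\<dots> = (\<integral>\<^sup>+w. emeasure lborel {0<..<m x w} \<partial>lborel)"
      by (intro nn_integral_cong arg_cong[where f = "emeasure lborel"]) (auto simp: A_def)
    finally show "emeasure (lborel \<Otimes>\<^sub>M lborel) (Pair x -` A) = (\<integral>\<^sup>+w. ennreal (m x w) \<partial>lborel)"
      by (simp add: nonneg)
  qed
  finally show "emeasure half_space_measure A = (\<integral>\<^sup>+x. \<integral>\<^sup>+w. ennreal (m x w) \<partial>lborel \<partial>lborel)" .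
qed

text \<open>A supremum stays below a level exactly when every term does, so both bounds together say
  that no point falls into the region \<open>A\<close> under the graph of the larger rescaled
  kernel. The bound \<open>0 \<le> V\<close> is there because \<open>ennreal V\<close> truncates
  negative numbers to 0.\<close>

lemma prob_moving_max_le:
  fixes X W Y :: "nat \<Rightarrow> 'a \<Rightarrow> real"
  assumes PP: "poisson_process M half_space_measure (\<lambda>j \<omega>. (X j \<omega>, W j \<omega>, Y j \<omega>))"
    and meas[measurable]: "case_prod \<phi> \<in> borel_measurable (borel \<Otimes>\<^sub>M borel)"
    and nonneg: "\<And>u1 u2. 0 \<le> \<phi> u1 u2"
    and w: "w1 > 0" "w2 > 0" and "0 \<le> V"
    and int: "(\<integral>\<^sup>+x. \<integral>\<^sup>+w. ennreal (max (\<phi> (x - s1) (w - s2) / w1) (\<phi> (x - t1) (w - t2) / w2))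
      \<partial>lborel \<partial>lborel) = ennreal V"
  shows "measure M {\<omega> \<in> space M. moving_max \<phi> X W Y s1 s2 \<omega> \<le> ereal w1 \<and>
      moving_max \<phi> X W Y t1 t2 \<omega> \<le> ereal w2} = exp (- V)"
proof -
  interpret poisson_process M half_space_measure "\<lambda>j \<omega>. (X j \<omega>, W j \<omega>, Y j \<omega>)" by fact
  define m where "m x w = max (\<phi> (x - s1) (w - s2) / w1) (\<phi> (x - t1) (w - t2) / w2)" for x w
  define A where "A = {(x, w, y). 0 < y \<and> y < m x w}"
  have "(\<lambda>z. max (case_prod \<phi> (fst z - s1, snd z - s2) / w1)
      (case_prod \<phi> (fst z - t1, snd z - t2) / w2)) \<in> borel_measurable (borel \<Otimes>\<^sub>M borel)"
    by measurable
  then have m: "case_prod m \<in> borel_measurable (borel \<Otimes>\<^sub>M borel)"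
    by (simp add: m_def[abs_def] case_prod_unfold)
  have m_nonneg: "0 \<le> m x w" for x w
    using nonneg w by (auto simp: m_def le_max_iff_disj)
  note A = emeasure_below_graph[OF m m_nonneg, folded A_def]
  have vol: "emeasure half_space_measure A = ennreal V"
    using A(2) int by (simp add: m_def)
  \<comment> \<open>Measurability into the restricted space puts the points in the open half-space
    for every \<open>\<omega>\<close> of the sample space. The two events below are therefore equal
    as sets, not just almost surely.\<close>
  have Y_pos: "0 < Y j \<omega>" if "\<omega> \<in> space M" for j \<omega>
    using measurable_space[OF measurable_point that, of j]
    by (simp add: half_space_measure_def space_restrict_space)
  have notin_A: "(X j \<omega>, W j \<omega>, Y j \<omega>) \<notin> A \<longleftrightarrow>
      \<phi> (X j \<omega> - s1) (W j \<omega> - s2) / Y j \<omega> \<le> w1 \<and>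
      \<phi> (X j \<omega> - t1) (W j \<omega> - t2) / Y j \<omega> \<le> w2" if "\<omega> \<in> space M" for j \<omega>
    using Y_pos[OF that, of j] w
    by (simp add: A_def m_def less_max_iff_disj not_less divide_le_eq le_divide_eq mult.commute)
  have "{\<omega> \<in> space M. moving_max \<phi> X W Y s1 s2 \<omega> \<le> ereal w1 \<and>
      moving_max \<phi> X W Y t1 t2 \<omega> \<le> ereal w2} =
      {\<omega> \<in> space M. \<forall>j. (X j \<omega>, W j \<omega>, Y j \<omega>) \<notin> A}"
    using notin_A by (fastforce simp: moving_max_def SUP_le_iff)
  then show ?thesis
    using prob_no_points[OF A(1)] vol \<open>0 \<le> V\<close> by (simp add: measure_def)
qed

section \<open>Linear substitution in a plane integral\<close>

text \<open>One step of Gaussian elimination reduces the substitution to two affine ones on the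
  line, each contributing the absolute value of a pivot.\<close>

lemma nn_integral_lborel_linear2:
  fixes F :: "real \<Rightarrow> real \<Rightarrow> ennreal"
  assumes [measurable]: "case_prod F \<in> borel_measurable (borel \<Otimes>\<^sub>M borel)"
    and det: "a * e - b * c \<noteq> 0"
  shows "(\<integral>\<^sup>+x. \<integral>\<^sup>+y. F (a * x + b * y) (c * x + e * y) \<partial>lborel \<partial>lborel) =
    (\<integral>\<^sup>+u. \<integral>\<^sup>+v. F u v \<partial>lborel \<partial>lborel) / ennreal \<bar>a * e - b * c\<bar>"
proof -
  have shear: "(\<integral>\<^sup>+y. \<integral>\<^sup>+x. F (a * x + b * y) (c * x + e * y) \<partial>lborel \<partial>lborel) =
      (\<integral>\<^sup>+u. \<integral>\<^sup>+v. F u v \<partial>lborel \<partial>lborel) / ennreal \<bar>a * e - b * c\<bar>"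
    if a: "a \<noteq> 0" and det: "a * e - b * c \<noteq> 0" for a b c e :: real
  proof -
    \<comment> \<open>For fixed \<open>y\<close>, put \<open>u = a * x + b * y\<close>; then
      \<open>c * x + e * y = c / a * u + k * y\<close>. So \<open>k\<close> is the second pivot, and
      the pivots \<open>a\<close> and \<open>k\<close> multiply to the determinant.\<close>
    define k where "k = (a * e - b * c) / a"
    have k: "k \<noteq> 0" using a det by (simp add: k_def)
    have eq: "c * ((u - b * y) / a) + e * y = c / a * u + k * y" for u y
      using a by (simp add: k_def field_simps)
    let ?I = "\<integral>\<^sup>+u. \<integral>\<^sup>+v. F u v \<partial>lborel \<partial>lborel"
    have "(\<integral>\<^sup>+y. F u (c / a * u + k * y) \<partial>lborel) = (\<integral>\<^sup>+v. F u v \<partial>lborel) / ennreal \<bar>k\<bar>" for u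
    proof -
      have "(\<integral>\<^sup>+v. F u v \<partial>lborel) = ennreal \<bar>k\<bar> * (\<integral>\<^sup>+y. F u (c / a * u + k * y) \<partial>lborel)"
        by (rule nn_integral_real_affine) (use k in auto)
      then show ?thesis
        using k by (simp add: ennreal_mult_divide_eq mult.commute[of "ennreal \<bar>k\<bar>"])
    qed
    note inner = this
    have "(\<integral>\<^sup>+y. \<integral>\<^sup>+x. F (a * x + b * y) (c * x + e * y) \<partial>lborel \<partial>lborel) =
        (\<integral>\<^sup>+y. (\<integral>\<^sup>+u. F u (c / a * u + k * y) \<partial>lborel) / ennreal \<bar>a\<bar> \<partial>lborel)"
    proof (intro nn_integral_cong)
      fix y :: real
      have "(\<integral>\<^sup>+u. F u (c / a * u + k * y) \<partial>lborel) =
          ennreal \<bar>a\<bar> * (\<integral>\<^sup>+x. F (b * y + a * x) (c / a * (b * y + a * x) + k * y) \<partial>lborel)"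
        by (rule nn_integral_real_affine) (use a in auto)
      also have "(\<lambda>x. F (b * y + a * x) (c / a * (b * y + a * x) + k * y)) =
          (\<lambda>x. F (a * x + b * y) (c * x + e * y))"
        using a by (intro ext arg_cong2[where f = F]) (auto simp: k_def field_simps)
      finally show "(\<integral>\<^sup>+x. F (a * x + b * y) (c * x + e * y) \<partial>lborel) =
          (\<integral>\<^sup>+u. F u (c / a * u + k * y) \<partial>lborel) / ennreal \<bar>a\<bar>"
        using a by (simp add: ennreal_mult_divide_eq mult.commute[of "ennreal \<bar>a\<bar>"])
    qed
    also have "\<dots> = (\<integral>\<^sup>+y. \<integral>\<^sup>+u. F u (c / a * u + k * y) \<partial>lborel \<partial>lborel) / ennreal \<bar>a\<bar>"
      by (rule nn_integral_divide) measurable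
    also have "(\<integral>\<^sup>+y. \<integral>\<^sup>+u. F u (c / a * u + k * y) \<partial>lborel \<partial>lborel) =
        (\<integral>\<^sup>+u. \<integral>\<^sup>+y. F u (c / a * u + k * y) \<partial>lborel \<partial>lborel)"
      by (rule lborel_pair.Fubini') measurable
    also have "\<dots> = (\<integral>\<^sup>+u. (\<integral>\<^sup>+v. F u v \<partial>lborel) / ennreal \<bar>k\<bar> \<partial>lborel)"
      by (simp only: inner)
    also have "\<dots> = ?I / ennreal \<bar>k\<bar>"
      by (rule nn_integral_divide) measurable
    also have "?I / ennreal \<bar>k\<bar> / ennreal \<bar>a\<bar> = ?I / ennreal \<bar>a * e - b * c\<bar>"
    proof -
      have "\<bar>k\<bar> * \<bar>a\<bar> = \<bar>a * e - b * c\<bar>"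
        using a by (simp add: k_def abs_divide)
      then show ?thesis
        using a k det by (simp add: divide_ennreal_def inverse_ennreal mult.assoc
            flip: ennreal_mult inverse_mult_distrib)
    qed
    finally show ?thesis .
  qed
  show ?thesis
  proof (cases "a = 0")
    case False
    have "(\<integral>\<^sup>+x. \<integral>\<^sup>+y. F (a * x + b * y) (c * x + e * y) \<partial>lborel \<partial>lborel) =
        (\<integral>\<^sup>+y. \<integral>\<^sup>+x. F (a * x + b * y) (c * x + e * y) \<partial>lborel \<partial>lborel)"
      by (rule lborel_pair.Fubini') measurable
    then show ?thesis
      using shear[OF False det] by simp
  next
    case True
    \<comment> \<open>Now \<open>b\<close> is nonzero and can serve as the pivot. Exchanging the
      columns only renames the two integration variables and flips the sign of the determinant,
      which the absolute value removes.\<close>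
    with det show ?thesis
      using shear[of b c a e] by (simp add: add.commute abs_mult mult.commute)
  qed
qed

section \<open>The one-dimensional integral of a maximum of two normal densities\<close>

lemma Phi_nn_integral:
  "ennreal (Phi b) = (\<integral>\<^sup>+v. ennreal (std_normal_density v) * indicator {..b} v \<partial>lborel)"
proof -
  interpret real_distribution std_normal_distribution
    by (rule real_dist_normal_dist)
  have "ennreal (Phi b) = emeasure std_normal_distribution {..b}"
    by (simp add: cdf_def emeasure_eq_measure)
  then show ?thesis
    by (simp add: emeasure_density)
qed

text \<open>Once the weights are moved into the exponents as \<open>- ln w1\<close> and
  \<open>- ln w2\<close>, the terms in the square of \<open>v\<close> cancel. The comparison becomes
  linear in \<open>v\<close> with slope \<open>q > 0\<close>, hence the single crossing.\<close>

lemma std_normal_density_crossing: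
  assumes "q > 0" "w1 > 0" "w2 > 0"
  shows "std_normal_density (v - q) / w2 \<le> std_normal_density v / w1 \<longleftrightarrow>
    v \<le> q / 2 + 1 / q * ln (w2 / w1)"
proof -
  have "std_normal_density (v - q) / w2 \<le> std_normal_density v / w1 \<longleftrightarrow>
      exp (- (v - q)\<^sup>2 / 2) / w2 \<le> exp (- v\<^sup>2 / 2) / w1"
    using divide_le_cancel[of "exp (- (v - q)\<^sup>2 / 2) / w2" "sqrt (2 * pi)" "exp (- v\<^sup>2 / 2) / w1"]
    by (simp add: std_normal_density_def mult.commute[of "sqrt _"])
  also have "\<dots> \<longleftrightarrow> exp (- (v - q)\<^sup>2 / 2 - ln w2) \<le> exp (- v\<^sup>2 / 2 - ln w1)"
    using assms by (simp add: exp_diff)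
  also have "\<dots> \<longleftrightarrow> v * q \<le> q * q / 2 + ln (w2 / w1)"
    using assms by (auto simp: ln_div power2_eq_square field_simps)
  also have "\<dots> \<longleftrightarrow> v \<le> q / 2 + 1 / q * ln (w2 / w1)"
    using assms by (simp add: field_simps)
  finally show ?thesis .
qed

text \<open>The first density is the larger one to the left of the crossing point and the second to
  its right, so the integral splits into two normal tails.\<close>

lemma nn_integral_max_std_normal:
  assumes "q > 0" "w1 > 0" "w2 > 0"
  shows "(\<integral>\<^sup>+v. ennreal (max (std_normal_density v / w1) (std_normal_density (v - q) / w2)) \<partial>lborel) =
    ennreal (1 / w1 * Phi (q / 2 + 1 / q * ln (w2 / w1)) +
      1 / w2 * Phi (q / 2 + 1 / q * ln (w1 / w2)))"
proof -
  define a where "a = q / 2 + 1 / q * ln (w2 / w1)"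
  \<comment> \<open>Reflection about \<open>q / 2\<close> exchanges the two densities, so the
    reflected crossing point is the same expression with \<open>w1\<close> and \<open>w2\<close>
    exchanged.\<close>
  have b: "q - a = q / 2 + 1 / q * ln (w1 / w2)"
    using assms by (simp add: a_def ln_div field_simps)
  let ?n = "std_normal_density"
  have Phi_nonneg: "0 \<le> Phi x" for x
    by (simp add: cdf_def)
  have "(\<integral>\<^sup>+v. ennreal (max (?n v / w1) (?n (v - q) / w2)) \<partial>lborel) =
      (\<integral>\<^sup>+v. ennreal (1 / w1) * (ennreal (?n v) * indicator {..a} v) +
        ennreal (1 / w2) * (ennreal (?n (v - q)) * indicator {a..} v) \<partial>lborel)"
  \<comment> \<open>Both closed half-lines contain \<open>a\<close>, where the right-hand side
    counts the common value twice; the identity holds off this single point.\<close>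
  proof (rule nn_integral_cong_AE)
    show "AE v in lborel. ennreal (max (?n v / w1) (?n (v - q) / w2)) =
      ennreal (1 / w1) * (ennreal (?n v) * indicator {..a} v) +
        ennreal (1 / w2) * (ennreal (?n (v - q)) * indicator {a..} v)"
      using AE_lborel_singleton[of a]
    proof eventually_elim
      case (elim v)
      have "?n (v - q) / w2 \<le> ?n v / w1 \<longleftrightarrow> v \<le> a"
        using std_normal_density_crossing[OF assms] by (simp add: a_def)
      then show ?case
        using elim assms by (cases "v \<le> a") (auto simp: max_def simp flip: ennreal_mult)
    qed
  qed
  also have "\<dots> = ennreal (1 / w1) * (\<integral>\<^sup>+v. ennreal (?n v) * indicator {..a} v \<partial>lborel) +
      ennreal (1 / w2) * (\<integral>\<^sup>+v. ennreal (?n (v - q)) * indicator {a..} v \<partial>lborel)"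
    by (simp add: nn_integral_add nn_integral_cmult)
  also have "(\<integral>\<^sup>+v. ennreal (?n (v - q)) * indicator {a..} v \<partial>lborel) =
      (\<integral>\<^sup>+v. ennreal (?n v) * indicator {..q - a} v \<partial>lborel)"
  proof -
    \<comment> \<open>Substitute \<open>q - v\<close> for \<open>v\<close>: the density is even, and
      the upper half-line turns into the lower one that \<open>Phi\<close> measures.\<close>
    have "(\<integral>\<^sup>+v. ennreal (?n (v - q)) * indicator {a..} v \<partial>lborel) = ennreal \<bar>- 1\<bar> *
        (\<integral>\<^sup>+v. ennreal (?n (q + - 1 * v - q)) * indicator {a..} (q + - 1 * v) \<partial>lborel)"
      by (rule nn_integral_real_affine) auto
    also have "\<dots> = (\<integral>\<^sup>+v. ennreal (?n v) * indicator {..q - a} v \<partial>lborel)"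
      by (auto simp: std_normal_density_def indicator_def intro!: nn_integral_cong)
    finally show ?thesis .
  qed
  finally show ?thesis
    unfolding b[symmetric] a_def[symmetric] using assms Phi_nonneg
    by (simp flip: Phi_nn_integral ennreal_mult ennreal_plus)
qed

section \<open>Standardising the bivariate normal density along the direction of the shift\<close>

text \<open>This is Lagrange's identity for the symmetric bilinear form with entries
  \<open>a\<close>, \<open>b\<close>, \<open>c\<close>: the last summand is the defect in the
  Cauchy-Schwarz inequality. Dividing by the form at \<open>t\<close> writes the form at
  \<open>s\<close> as a sum of two squares of linear functions of \<open>s\<close>, which are the
  standardising coordinates.\<close>

lemma quadratic_form_lagrange:
  fixes a b c :: real
  shows "(a * s1\<^sup>2 + 2 * b * s1 * s2 + c * s2\<^sup>2) * (a * t1\<^sup>2 + 2 * b * t1 * t2 + c * t2\<^sup>2) =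
    ((a * t1 + b * t2) * s1 + (b * t1 + c * t2) * s2)\<^sup>2 + (a * c - b\<^sup>2) * (t1 * s2 - t2 * s1)\<^sup>2"
  by algebra

lemma Sigma_inv_quadratic_form:
  "vector [t1, t2] \<bullet> (Sigma_inv \<beta>1 \<beta>2 \<rho> *v vector [t1, t2]) =
    \<beta>1\<^sup>2 / (1 - \<rho>\<^sup>2) * t1\<^sup>2 + 2 * (- \<rho> * \<beta>1 * \<beta>2 / (1 - \<rho>\<^sup>2)) * t1 * t2 + \<beta>2\<^sup>2 / (1 - \<rho>\<^sup>2) * t2\<^sup>2"
  by (simp add: Sigma_inv_def inner_vec_def matrix_vector_mult_def sum_2 power2_eq_square)
    (simp add: algebra_simps add_divide_distrib diff_divide_distrib)

lemma normal_density2_nonneg: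
  assumes "\<beta>1 > 0" "\<beta>2 > 0" "-1 < \<rho>" "\<rho> < 1"
  shows "0 \<le> normal_density2 \<beta>1 \<beta>2 \<rho> u1 u2"
proof -
  have "\<rho>\<^sup>2 < 1" using assms by (simp add: abs_square_less_1)
  then show ?thesis using assms by (simp add: normal_density2_def)
qed

lemma measurable_normal_density2:
  "case_prod (normal_density2 \<beta>1 \<beta>2 \<rho>) \<in> borel_measurable (borel \<Otimes>\<^sub>M borel)"
  unfolding normal_density2_def[abs_def] by measurable

text \<open>In the standardising coordinates both densities share the same factor in the second
  coordinate, so it can be pulled out of the maximum and integrates to 1.\<close>

lemma nn_integral_max_normal_density2:
  assumes "\<beta>1 > 0" "\<beta>2 > 0" "-1 < \<rho>" "\<rho> < 1" "w1 > 0" "w2 > 0"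
    and t0: "(t1, t2) \<noteq> (0, 0)"
    and q_def: "q = sqrt (vector [t1, t2] \<bullet> (Sigma_inv \<beta>1 \<beta>2 \<rho> *v vector [t1, t2]))"
  shows "(\<integral>\<^sup>+x. \<integral>\<^sup>+w. ennreal (max (normal_density2 \<beta>1 \<beta>2 \<rho> x w / w1)
      (normal_density2 \<beta>1 \<beta>2 \<rho> (x - t1) (w - t2) / w2)) \<partial>lborel \<partial>lborel) =
    ennreal (1 / w1 * Phi (q / 2 + 1 / q * ln (w2 / w1)) +
      1 / w2 * Phi (q / 2 + 1 / q * ln (w1 / w2)))" (is "_ = ennreal ?V")
proof -
  define a b c where "a = \<beta>1\<^sup>2 / (1 - \<rho>\<^sup>2)" and "b = - \<rho> * \<beta>1 * \<beta>2 / (1 - \<rho>\<^sup>2)"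
    and "c = \<beta>2\<^sup>2 / (1 - \<rho>\<^sup>2)"
  define Q where "Q s1 s2 = a * s1\<^sup>2 + 2 * b * s1 * s2 + c * s2\<^sup>2" for s1 s2
  \<comment> \<open>This is the square root of the determinant of \<open>Sigma_inv\<close>; the
    normalising constant of the density is \<open>d / (2 * pi)\<close>.\<close>
  define d where "d = \<beta>1 * \<beta>2 / sqrt (1 - \<rho>\<^sup>2)"
  have rho: "\<rho>\<^sup>2 < 1" using assms by (simp add: abs_square_less_1)
  have d: "d > 0" using assms rho by (simp add: d_def)
  have d2: "a * c - b\<^sup>2 = d\<^sup>2"
  proof -
    have "a * c - b\<^sup>2 = (\<beta>1 * \<beta>2)\<^sup>2 * (1 - \<rho>\<^sup>2) / (1 - \<rho>\<^sup>2)\<^sup>2"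
      by (simp add: a_def b_def c_def power_mult_distrib power_divide)
        (simp add: power2_eq_square diff_divide_distrib[symmetric] algebra_simps)
    also have "\<dots> = d\<^sup>2"
      using rho by (simp add: d_def power_divide power2_eq_square[of "1 - \<rho>\<^sup>2"])
    finally show ?thesis .
  qed
  have a: "a > 0" using assms rho by (simp add: a_def)
  \<comment> \<open>Completing the square shows positive definiteness. If \<open>t2 = 0\<close>,
    then \<open>t1\<close> is nonzero and the first square is positive.\<close>
  have "a * Q t1 t2 = (a * t1 + b * t2)\<^sup>2 + d\<^sup>2 * t2\<^sup>2"
    unfolding d2[symmetric] Q_def by algebra
  also have "\<dots> > 0"
  proof (cases "t2 = 0")
    case True
    then show ?thesis using t0 a by simp
  next
    case False
    then show ?thesis using d by (simp add: add_nonneg_pos)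
  qed
  finally have Q_pos: "Q t1 t2 > 0" using a by (simp add: zero_less_mult_iff)
  have q_Q: "q = sqrt (Q t1 t2)"
    unfolding q_def Sigma_inv_quadratic_form by (simp add: Q_def a_def b_def c_def)
  have q: "q > 0" and q2: "q\<^sup>2 = Q t1 t2"
    using Q_pos by (auto simp: q_Q)
  \<comment> \<open>The rows of the standardising map, read off from the two squares in
    \<open>quadratic_form_lagrange\<close> after division by \<open>q\<close>.\<close>
  define a' b' c' e' where "a' = (a * t1 + b * t2) / q" and "b' = (b * t1 + c * t2) / q"
    and "c' = - d * t2 / q" and "e' = d * t1 / q"
  \<comment> \<open>The determinant is exactly the prefactor of the density in \<open>dens\<close>,
    so the two cancel after the substitution.\<close>
  have det: "a' * e' - b' * c' = d"
  proof -
    have "a' * e' - b' * c' = d * Q t1 t2 / q\<^sup>2"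
      using q by (simp add: a'_def b'_def c'_def e'_def Q_def field_simps power2_eq_square)
    then show ?thesis using Q_pos q2 by simp
  qed
  have Q_eq: "Q s1 s2 = (a' * s1 + b' * s2)\<^sup>2 + (c' * s1 + e' * s2)\<^sup>2" for s1 s2
  proof -
    have "a' * s1 + b' * s2 = ((a * t1 + b * t2) * s1 + (b * t1 + c * t2) * s2) / q"
      using q by (simp add: a'_def b'_def field_simps)
    moreover have "c' * s1 + e' * s2 = d * (t1 * s2 - t2 * s1) / q"
      by (simp add: c'_def e'_def algebra_simps diff_divide_distrib)
    ultimately have "(a' * s1 + b' * s2)\<^sup>2 + (c' * s1 + e' * s2)\<^sup>2 = Q s1 s2 * Q t1 t2 / q\<^sup>2"
      unfolding Q_def quadratic_form_lagrange d2
      by (simp add: power_divide power_mult_distrib flip: add_divide_distrib)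
    then show ?thesis using Q_pos q2 by simp
  qed
  let ?n = "std_normal_density"
  have dens: "normal_density2 \<beta>1 \<beta>2 \<rho> s1 s2 =
      d * (?n (a' * s1 + b' * s2) * ?n (c' * s1 + e' * s2))" for s1 s2
  proof -
    have "?n u * ?n v = exp (- (u\<^sup>2 + v\<^sup>2) / 2) / (2 * pi)" for u v
      by (simp add: std_normal_density_def flip: exp_add)
    then have "d * (?n (a' * s1 + b' * s2) * ?n (c' * s1 + e' * s2)) =
        d * exp (- Q s1 s2 / 2) / (2 * pi)"
      by (simp add: Q_eq)
    moreover have "- Q s1 s2 / 2 = - (1 / (2 * (1 - \<rho>\<^sup>2))) *
        (\<beta>1\<^sup>2 * s1\<^sup>2 - 2 * \<rho> * \<beta>1 * \<beta>2 * s1 * s2 + \<beta>2\<^sup>2 * s2\<^sup>2)"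
      unfolding Q_def a_def b_def c_def
      by (simp add: add_divide_distrib diff_divide_distrib algebra_simps)
    ultimately show ?thesis
      unfolding normal_density2_def by (simp only: d_def) (simp add: mult_ac)
  qed
  \<comment> \<open>The map sends \<open>t\<close> to \<open>(q, 0)\<close>: the first row gives
    \<open>Q t1 t2 / q = q\<close>, and the second is a cross product with \<open>t\<close>. A shift
    by \<open>t\<close> thus moves only the first coordinate.\<close>
  have shift: "a' * (s1 - t1) + b' * (s2 - t2) = a' * s1 + b' * s2 - q"
    "c' * (s1 - t1) + e' * (s2 - t2) = c' * s1 + e' * s2" for s1 s2
  proof -
    have "a' * t1 + b' * t2 = Q t1 t2 / q"
      by (simp add: a'_def b'_def Q_def add_divide_distrib algebra_simps power2_eq_square)
    also have "\<dots> = q" using q by (simp add: power2_eq_square flip: q2)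
    finally show "a' * (s1 - t1) + b' * (s2 - t2) = a' * s1 + b' * s2 - q"
      by (simp add: algebra_simps)
    show "c' * (s1 - t1) + e' * (s2 - t2) = c' * s1 + e' * s2"
      using q by (simp add: c'_def e'_def field_simps)
  qed
  define g where "g u = max (?n u / w1) (?n (u - q) / w2)" for u
  have g_nonneg: "0 \<le> g u" for u
    using assms by (simp add: g_def le_max_iff_disj)
  have [measurable]: "g \<in> borel_measurable borel"
    unfolding g_def[abs_def] by measurable
  have max_eq: "max (normal_density2 \<beta>1 \<beta>2 \<rho> x w / w1)
      (normal_density2 \<beta>1 \<beta>2 \<rho> (x - t1) (w - t2) / w2) =
      d * (g (a' * x + b' * w) * ?n (c' * x + e' * w))" for x w
  proof -
    have scale: "max (d * (u * k) / w1) (d * (v * k) / w2) = d * (max (u / w1) (v / w2) * k)"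
      if "0 \<le> k" for u v k :: real
    proof -
      have "d * (max (u / w1) (v / w2) * k) = d * k * max (u / w1) (v / w2)" by simp
      also have "\<dots> = max (d * k * (u / w1)) (d * k * (v / w2))"
        using that d by (simp add: max_mult_distrib_left)
      finally show ?thesis by (simp add: mult_ac)
    qed
    show ?thesis
      unfolding dens shift g_def by (rule scale) simp
  qed
  define F where "F u v = ennreal (d * (g u * ?n v))" for u v
  have [measurable]: "case_prod F \<in> borel_measurable (borel \<Otimes>\<^sub>M borel)"
    unfolding F_def[abs_def] by measurable
  have n_int: "(\<integral>\<^sup>+v. ennreal (?n v) \<partial>lborel) = 1"
    using prob_space.emeasure_space_1[OF prob_space_normal_density[of 1 0]]
    by (simp add: emeasure_density)
  have "(\<integral>\<^sup>+x. \<integral>\<^sup>+w. ennreal (max (normal_density2 \<beta>1 \<beta>2 \<rho> x w / w1)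
      (normal_density2 \<beta>1 \<beta>2 \<rho> (x - t1) (w - t2) / w2)) \<partial>lborel \<partial>lborel) =
      (\<integral>\<^sup>+x. \<integral>\<^sup>+w. F (a' * x + b' * w) (c' * x + e' * w) \<partial>lborel \<partial>lborel)"
    by (simp add: max_eq F_def)
  also have "\<dots> = (\<integral>\<^sup>+u. \<integral>\<^sup>+v. F u v \<partial>lborel \<partial>lborel) / ennreal d"
    using d by (subst nn_integral_lborel_linear2) (simp_all add: det)
  \<comment> \<open>The second coordinate integrates out here, which leaves the one-dimensional
    maximum \<open>g\<close>.\<close>
  also have "(\<integral>\<^sup>+u. \<integral>\<^sup>+v. F u v \<partial>lborel \<partial>lborel) = (\<integral>\<^sup>+u. ennreal d * ennreal (g u) \<partial>lborel)"
    using d g_nonneg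
    by (simp add: F_def ennreal_mult mult.assoc[symmetric] nn_integral_cmult n_int)
  also have "\<dots> = ennreal d * (\<integral>\<^sup>+u. ennreal (g u) \<partial>lborel)"
    by (rule nn_integral_cmult) measurable
  also have "(\<integral>\<^sup>+u. ennreal (g u) \<partial>lborel) = ennreal ?V"
    unfolding g_def by (rule nn_integral_max_std_normal) (use q assms in auto)
  also have "ennreal d * ennreal ?V / ennreal d = ennreal ?V"
    using d by (simp add: ennreal_mult_divide_eq mult.commute[of "ennreal d"])
  finally show ?thesis .
qed

theorem proposition2p7:
  fixes M :: "'a measure"
    and X W Y :: "nat \<Rightarrow> 'a \<Rightarrow> real"
    and \<beta>1 \<beta>2 \<rho> t1 t2 w1 w2 :: real
    and t :: "real ^ 2"
    and Z :: "real \<Rightarrow> real \<Rightarrow> 'a \<Rightarrow> ereal"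
    and q :: real
  assumes "\<beta>1 > 0" and "\<beta>2 > 0" and "-1 < \<rho>" and "\<rho> < 1"
    and "poisson_process M half_space_measure (\<lambda>j \<omega>. (X j \<omega>, W j \<omega>, Y j \<omega>))"
    and "w1 > 0" and "w2 > 0"
  defines "Z \<equiv> moving_max (normal_density2 \<beta>1 \<beta>2 \<rho>) X W Y"
    and "t \<equiv> vector [t1, t2]"
    and "q \<equiv> sqrt (t \<bullet> (Sigma_inv \<beta>1 \<beta>2 \<rho> *v t))"
  assumes "t \<noteq> 0"
  shows "- ln (measure M {\<omega> \<in> space M. Z 0 0 \<omega> \<le> ereal w1 \<and> Z t1 t2 \<omega> \<le> ereal w2}) =
    1 / w1 * Phi (q / 2 + 1 / q * ln (w2 / w1)) +
    1 / w2 * Phi (q / 2 + 1 / q * ln (w1 / w2))"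
    (is "_ = ?V")
proof -
  have t0: "(t1, t2) \<noteq> (0, 0)"
    using \<open>t \<noteq> 0\<close> by (auto simp: t_def vec_eq_iff forall_2)
  have "0 \<le> ?V"
    using \<open>w1 > 0\<close> \<open>w2 > 0\<close> by (simp add: cdf_def)
  \<comment> \<open>The zero shifts are kept so that this has the form of the integral hypothesis of
    \<open>prob_moving_max_le\<close>, with the origin as first site.\<close>
  moreover have "(\<integral>\<^sup>+x. \<integral>\<^sup>+w. ennreal (max (normal_density2 \<beta>1 \<beta>2 \<rho> (x - 0) (w - 0) / w1)
      (normal_density2 \<beta>1 \<beta>2 \<rho> (x - t1) (w - t2) / w2)) \<partial>lborel \<partial>lborel) = ennreal ?V"
    unfolding diff_zero by (rule nn_integral_max_normal_density2) (use assms t0 in auto)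
  ultimately have "measure M {\<omega> \<in> space M. Z 0 0 \<omega> \<le> ereal w1 \<and> Z t1 t2 \<omega> \<le> ereal w2} = exp (- ?V)"
    unfolding Z_def
    by (intro prob_moving_max_le measurable_normal_density2 normal_density2_nonneg assms)
  then show ?thesis by simp
qed

end
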